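(* Let $(X,\tau)$ be a $T_0$ space, and let $\mathcal{D}(X)$ be the poset of all nonempty compact saturated subsets of $X$ ordered by reverse inclusion ($K_1\le K_2$ iff $K_1\supseteq K_2$), with Scott topology $\sigma(\mathcal{D}(X))$. Suppose that (i) the upper Vietoris topology on $\mathcal{D}(X)$ is contained in $\sigma(\mathcal{D}(X))$; (ii) the mapping $\xi_X^{\sigma}:(X,\tau)\to(\mathcal{D}(X),\sigma(\mathcal{D}(X)))$, $\xi_X^{\sigma}(x)={\uparrow}x$, is continuous; and (iii) $(\mathcal{D}(X),\sigma(\mathcal{D}(X)))$ is sober. Then $X$ is sober.
   Context: For a poset $P$, a subset $U\subseteq P$ is Scott open if (i) $U$ is an upper set, i.e. $U={\uparrow}U=\{x\in P: y\le x\text{ for some }y\in U\}$, and (ii) for every (nonempty) directed subset $D\subseteq P$ whose supremum $\bigvee D$ exists, $\bigvee D\in U$ implies $D\cap U\neq\emptyset$. The Scott open sets form the Scott topology $\sigma(P)$. A subset of a topological space is saturated if it equals the intersection of all open sets containing it. Compact means every open cover has a finite subcover (no Hausdorff condition). The specialization order $\leq_\tau$ on a $T_0$ space $(X,\tau)$ is given by $x\leq_\tau y$ iff $x\in cl(\{y\})$, where $cl$ is closure; and ${\uparrow}x=\{y\in X:x\leq_\tau y\}$, which is an element of $\mathcal{D}(X)$. The upper Vietoris topology on $\mathcal{D}(X)$ is the topology having as a base the sets $\Box U=\{K\in\mathcal{D}(X):K\subseteq U\}$, $U$ ranging over the open subsets of $X$. A nonempty subset $A$ of a space $X$ is irreducible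 if for any closed subsets $F_1,F_2$ of $X$, $A\subseteq F_1\cup F_2$ implies $A\subseteq F_1$ or $A\subseteq F_2$. A space $X$ is sober if every irreducible closed subset of $X$ is the closure of a unique singleton. *)

theory Defs
  imports "HOL-Algebra.Order" "HOL-Analysis.Analysis"
begin

text \<open>Posets are the carrier-based structures of \<^theory>\<open>HOL-Algebra.Order\<close>; the supremum of a
  set is its least upper bound within the carrier.\<close>

subsection \<open>The Scott topology\<close>

definition directed_in :: "('a, 'b) gorder_scheme \<Rightarrow> 'a set \<Rightarrow> bool" where
  "directed_in P D \<longleftrightarrow> D \<subseteq> carrier P \<and> D \<noteq> {} \<and>
     (\<forall>x\<in>D. \<forall>y\<in>D. \<exists>z\<in>D. x \<sqsubseteq>\<^bsub>P\<^esub> z \<and> y \<sqsubseteq>\<^bsub>P\<^esub> z)"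

definition scott_open :: "('a, 'b) gorder_scheme \<Rightarrow> 'a set \<Rightarrow> bool" where
  "scott_open P U \<longleftrightarrow> U \<subseteq> carrier P \<and>
     U = {x \<in> carrier P. \<exists>y\<in>U. y \<sqsubseteq>\<^bsub>P\<^esub> x} \<and>
     (\<forall>D s. directed_in P D \<and> is_lub P s D \<and> s \<in> U \<longrightarrow> D \<inter> U \<noteq> {})"

definition scott_topology :: "('a, 'b) gorder_scheme \<Rightarrow> 'a topology" where
  "scott_topology P = topology (scott_open P)"

lemma scott_open_iff:
  assumes "partial_order P"
  shows "scott_open P U \<longleftrightarrow> U \<subseteq> carrier P \<and>
    (\<forall>x\<in>U. \<forall>y\<in>carrier P. x \<sqsubseteq>\<^bsub>P\<^esub> y \<longrightarrow> y \<in> U) \<and>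
    (\<forall>D s. directed_in P D \<and> is_lub P s D \<and> s \<in> U \<longrightarrow> D \<inter> U \<noteq> {})"
proof -
  interpret partial_order P by fact
  have "U = {x \<in> carrier P. \<exists>y\<in>U. y \<sqsubseteq>\<^bsub>P\<^esub> x} \<longleftrightarrow>
      (\<forall>x\<in>U. \<forall>y\<in>carrier P. x \<sqsubseteq>\<^bsub>P\<^esub> y \<longrightarrow> y \<in> U)" if "U \<subseteq> carrier P"
    using that le_refl by blast
  then show ?thesis
    unfolding scott_open_def by meson
qed

lemma istopology_scott_open:
  assumes "partial_order P"
  shows "istopology (scott_open P)"
  unfolding istopology_def
proof (intro conjI allI impI)
  note iff = scott_open_iff[OF assms]
  fix S T
  assume "scott_open P S" and "scott_open P T"
  then have S: "S \<subseteq> carrier P" "\<And>x y. x \<in> S \<Longrightarrow> y \<in> carrier P \<Longrightarrow> x \<sqsubseteq>\<^bsub>P\<^esub> y \<Longrightarrow> y \<in> S"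
      "\<And>D s. directed_in P D \<Longrightarrow> is_lub P s D \<Longrightarrow> s \<in> S \<Longrightarrow> \<exists>a. a \<in> D \<and> a \<in> S"
    and T: "T \<subseteq> carrier P" "\<And>x y. x \<in> T \<Longrightarrow> y \<in> carrier P \<Longrightarrow> x \<sqsubseteq>\<^bsub>P\<^esub> y \<Longrightarrow> y \<in> T"
      "\<And>D s. directed_in P D \<Longrightarrow> is_lub P s D \<Longrightarrow> s \<in> T \<Longrightarrow> \<exists>a. a \<in> D \<and> a \<in> T"
    unfolding iff by (simp_all add: disjoint_iff) metis+
  show "scott_open P (S \<inter> T)"
    unfolding iff
  proof (intro conjI allI ballI impI)
    show "S \<inter> T \<subseteq> carrier P"
      using S(1) by auto
  next
    fix x y
    assume "x \<in> S \<inter> T" "y \<in> carrier P" "x \<sqsubseteq>\<^bsub>P\<^esub> y"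
    then show "y \<in> S \<inter> T"
      using S(2) T(2) by auto
  next
    fix D s
    assume D: "directed_in P D \<and> is_lub P s D \<and> s \<in> S \<inter> T"
    obtain a where a: "a \<in> D" "a \<in> S"
      using D S(3) by (meson IntD1)
    obtain b where b: "b \<in> D" "b \<in> T"
      using D T(3) by (meson IntD2)
    obtain c where c: "c \<in> D" "a \<sqsubseteq>\<^bsub>P\<^esub> c" "b \<sqsubseteq>\<^bsub>P\<^esub> c" "c \<in> carrier P"
      using D a(1) b(1) unfolding directed_in_def by (meson subsetD)
    then have "c \<in> S" "c \<in> T"
      using S(2) T(2) a b by auto
    then show "D \<inter> (S \<inter> T) \<noteq> {}"
      using c(1) by auto
  qed
next
  note iff = scott_open_iff[OF assms]
  fix \<K>
  assume K: "\<forall>K\<in>\<K>. scott_open P K"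
  show "scott_open P (\<Union>\<K>)"
    unfolding iff
  proof (intro conjI allI ballI impI)
    show "\<Union>\<K> \<subseteq> carrier P"
      using K by (auto simp: scott_open_def)
  next
    fix x y
    assume "x \<in> \<Union>\<K>" "y \<in> carrier P" "x \<sqsubseteq>\<^bsub>P\<^esub> y"
    then show "y \<in> \<Union>\<K>"
      using K unfolding iff by (meson Union_iff)
  next
    fix D s
    assume D: "directed_in P D \<and> is_lub P s D \<and> s \<in> \<Union>\<K>"
    then obtain K where "K \<in> \<K>" "s \<in> K"
      by auto
    then have "D \<inter> K \<noteq> {}"
      using K D unfolding iff by meson
    then show "D \<inter> \<Union>\<K> \<noteq> {}"
      using \<open>K \<in> \<K>\<close> by auto
  qed
qed

lemma openin_scott_topology:
  "partial_order P \<Longrightarrow> openin (scott_topology P) U \<longleftrightarrow> scott_open P U"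
  by (simp add: scott_topology_def istopology_scott_open)

lemma topspace_scott_topology:
  assumes "partial_order P"
  shows "topspace (scott_topology P) = carrier P"
proof
  show "topspace (scott_topology P) \<subseteq> carrier P"
    using openin_topspace[of "scott_topology P"] unfolding openin_scott_topology[OF assms]
    by (simp add: scott_open_def)
  have "scott_open P (carrier P)"
    unfolding scott_open_iff[OF assms] directed_in_def by auto
  then show "carrier P \<subseteq> topspace (scott_topology P)"
    by (simp add: openin_scott_topology[OF assms] openin_subset)
qed

subsection \<open>Saturated sets, specialization order, sobriety\<close>

text \<open>The condition \<open>A \<subseteq> topspace X\<close> excludes the case where no open set contains \<open>A\<close> and the
  intersection degenerates to \<^term>\<open>UNIV\<close>.\<close>

definition saturated_in :: "'a topology \<Rightarrow> 'a set \<Rightarrow> bool" where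
  "saturated_in X A \<longleftrightarrow> A \<subseteq> topspace X \<and> A = \<Inter>{U. openin X U \<and> A \<subseteq> U}"

definition specialization_le :: "'a topology \<Rightarrow> 'a \<Rightarrow> 'a \<Rightarrow> bool" where
  "specialization_le X x y \<longleftrightarrow> x \<in> X closure_of {y}"

definition up_set :: "'a topology \<Rightarrow> 'a \<Rightarrow> 'a set" where
  "up_set X x = {y \<in> topspace X. specialization_le X x y}"

definition irreducible_in :: "'a topology \<Rightarrow> 'a set \<Rightarrow> bool" where
  "irreducible_in X A \<longleftrightarrow> A \<subseteq> topspace X \<and> A \<noteq> {} \<and>
     (\<forall>F1 F2. closedin X F1 \<and> closedin X F2 \<and> A \<subseteq> F1 \<union> F2 \<longrightarrow> A \<subseteq> F1 \<or> A \<subseteq> F2)"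

definition sober_space :: "'a topology \<Rightarrow> bool" where
  "sober_space X \<longleftrightarrow>
     (\<forall>A. closedin X A \<and> irreducible_in X A \<longrightarrow> (\<exists>!x. x \<in> topspace X \<and> A = X closure_of {x}))"

subsection \<open>The poset of nonempty compact saturated subsets\<close>

definition compact_saturated_sets :: "'a topology \<Rightarrow> 'a set set" where
  "compact_saturated_sets X = {K. K \<noteq> {} \<and> compactin X K \<and> saturated_in X K}"

definition smyth_poset :: "'a topology \<Rightarrow> 'a set gorder" where
  "smyth_poset X = \<lparr>carrier = compact_saturated_sets X, eq = (=), le = (\<lambda>K1 K2. K1 \<supseteq> K2)\<rparr>"

lemma partial_order_smyth_poset: "partial_order (smyth_poset X)"
  by unfold_locales (auto simp: smyth_poset_def)

lemma up_set_in_compact_saturated_sets: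
  assumes "x \<in> topspace X"
  shows "up_set X x \<in> compact_saturated_sets X"
proof -
  have eq: "up_set X x = {y \<in> topspace X. \<forall>U. openin X U \<and> x \<in> U \<longrightarrow> y \<in> U}"
    using assms by (auto simp: up_set_def specialization_le_def in_closure_of)
  have x: "x \<in> up_set X x"
    using assms by (simp add: eq)
  have "compactin X (up_set X x)"
    unfolding compactin_def
  proof (intro conjI allI impI)
    show "up_set X x \<subseteq> topspace X"
      by (auto simp: eq)
    fix \<U>
    assume U: "Ball \<U> (openin X) \<and> up_set X x \<subseteq> \<Union>\<U>"
    then obtain U where "U \<in> \<U>" "x \<in> U"
      using x by blast
    then show "\<exists>\<F>. finite \<F> \<and> \<F> \<subseteq> \<U> \<and> up_set X x \<subseteq> \<Union>\<F>"
      using U by (intro exI[of _ "{U}"]) (auto simp: eq)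
  qed
  moreover have "saturated_in X (up_set X x)"
  proof -
    have "y \<in> up_set X x" if y: "\<And>U. openin X U \<Longrightarrow> up_set X x \<subseteq> U \<Longrightarrow> y \<in> U" for y
    proof -
      have "up_set X x \<subseteq> U" if "openin X U" "x \<in> U" for U
        using that by (auto simp: eq)
      then have "y \<in> U" if "openin X U" "x \<in> U" for U
        using that y by blast
      then show ?thesis
        using assms openin_topspace[of X] unfolding eq by blast
    qed
    then have "\<Inter>{U. openin X U \<and> up_set X x \<subseteq> U} \<subseteq> up_set X x"
      by auto
    moreover have "up_set X x \<subseteq> topspace X"
      by (auto simp: eq)
    ultimately show ?thesis
      unfolding saturated_in_def by blast
  qed
  ultimately show ?thesis
    using x by (auto simp: compact_saturated_sets_def)
qed

definition vietoris_box :: "'a topology \<Rightarrow> 'a set \<Rightarrow> 'a set set" where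
  "vietoris_box X U = {K \<in> compact_saturated_sets X. K \<subseteq> U}"

definition upper_vietoris :: "'a topology \<Rightarrow> 'a set topology" where
  "upper_vietoris X = topology (arbitrary union_of (\<lambda>W. \<exists>U. openin X U \<and> W = vietoris_box X U))"

lemma openin_upper_vietoris:
  "openin (upper_vietoris X) W \<longleftrightarrow>
     (arbitrary union_of (\<lambda>W. \<exists>U. openin X U \<and> W = vietoris_box X U)) W"
proof -
  have "vietoris_box X U \<inter> vietoris_box X V = vietoris_box X (U \<inter> V)" for U V
    by (auto simp: vietoris_box_def)
  then have "istopology (arbitrary union_of (\<lambda>W. \<exists>U. openin X U \<and> W = vietoris_box X U))"
    by (intro istopology_base) (metis openin_Int)
  then show ?thesis
    by (simp add: upper_vietoris_def)
qed

lemma topspace_upper_vietoris: "topspace (upper_vietoris X) = compact_saturated_sets X"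
proof
  show "topspace (upper_vietoris X) \<subseteq> compact_saturated_sets X"
    by (fastforce simp: topspace_def openin_upper_vietoris union_of_def vietoris_box_def)
  have "openin (upper_vietoris X) (vietoris_box X (topspace X))"
    unfolding openin_upper_vietoris by (intro arbitrary_union_of_inc) auto
  moreover have "vietoris_box X (topspace X) = compact_saturated_sets X"
    by (auto simp: vietoris_box_def compact_saturated_sets_def saturated_in_def)
  ultimately show "compact_saturated_sets X \<subseteq> topspace (upper_vietoris X)"
    by (metis openin_subset)
qed

end

theory Submission
  imports Defs
begin

text \<open>Let \<open>A\<close> be closed and irreducible in \<open>X\<close>. The closure of its image under \<open>x \<mapsto> \<up>x\<close> is
  irreducible in the Scott topology, hence is the closure of a point \<open>K\<close>. The set \<open>K\<close> meets \<open>A\<close>: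
  otherwise \<open>\<box>(X - A)\<close> would be an open neighbourhood of \<open>K\<close> missing the image of \<open>A\<close>. Moreover
  \<open>K \<subseteq> \<up>x\<close> for all \<open>x \<in> A\<close>, as every box containing \<open>\<up>x\<close> contains \<open>K\<close>. So any point of \<open>K \<inter> A\<close> is
  an upper bound of \<open>A\<close> in the specialization order, and \<open>A\<close> is its closure.\<close>

text \<open>Preimages under \<open>f\<close> turn a cover of the image by two closed sets into such
  a cover of \<open>A\<close>.\<close>

lemma irreducible_in_continuous_map_image:
  assumes f: "continuous_map X Y f" and A: "irreducible_in X A"
  shows "irreducible_in Y (f ` A)"
  unfolding irreducible_in_def
proof (intro conjI allI impI)
  show "f ` A \<subseteq> topspace Y"
    using A continuous_map_image_subset_topspace[OF f] by (auto simp: irreducible_in_def)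
  show "f ` A \<noteq> {}"
    using A by (simp add: irreducible_in_def)
  fix F1 F2
  assume F: "closedin Y F1 \<and> closedin Y F2 \<and> f ` A \<subseteq> F1 \<union> F2"
  define G where "G F = {x \<in> topspace X. f x \<in> F}" for F
  have "closedin X (G F1)" "closedin X (G F2)"
    using F f unfolding G_def by (auto intro: closedin_continuous_map_preimage)
  moreover have "A \<subseteq> G F1 \<union> G F2"
    using A F by (auto simp: irreducible_in_def G_def)
  ultimately have "A \<subseteq> G F1 \<or> A \<subseteq> G F2"
    using A by (simp add: irreducible_in_def)
  then show "f ` A \<subseteq> F1 \<or> f ` A \<subseteq> F2"
    by (auto simp: G_def)
qed

text \<open>A closed set that contains \<open>A\<close> already contains its closure, so it suffices
  to decide for \<open>A\<close> which piece of the cover to take.\<close>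

lemma irreducible_in_closure_of:
  assumes "irreducible_in X A"
  shows "irreducible_in X (X closure_of A)"
  unfolding irreducible_in_def
proof (intro conjI allI impI)
  have "A \<subseteq> X closure_of A"
    using assms by (simp add: closure_of_subset irreducible_in_def)
  then show "X closure_of A \<noteq> {}"
    using assms by (auto simp: irreducible_in_def)
  fix F1 F2
  assume "closedin X F1 \<and> closedin X F2 \<and> X closure_of A \<subseteq> F1 \<union> F2"
  then show "X closure_of A \<subseteq> F1 \<or> X closure_of A \<subseteq> F2"
    using assms \<open>A \<subseteq> X closure_of A\<close> unfolding irreducible_in_def
    by (meson closure_of_minimal subset_trans)
qed (rule closure_of_subset_topspace)

text \<open>An open set separating \<open>x\<close> from \<open>y\<close> would keep one of them out
  of the closure of the other. This gives uniqueness of the generic point.\<close>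

lemma t0_space_closure_of_singleton_inj:
  assumes "t0_space X" "x \<in> topspace X" "y \<in> topspace X" "X closure_of {x} = X closure_of {y}"
  shows "x = y"
proof (rule ccontr)
  assume "x \<noteq> y"
  then obtain U where "openin X U" "x \<notin> U \<longleftrightarrow> y \<in> U"
    using assms(1-3) unfolding t0_space_def by meson
  moreover have "x \<in> X closure_of {y}" "y \<in> X closure_of {x}"
    using assms closure_of_subset[of "{x}" X] closure_of_subset[of "{y}" X] by auto
  ultimately show False
    by (auto simp: in_closure_of)
qed

lemma mem_up_set_iff:
  "x \<in> topspace X \<Longrightarrow>
     y \<in> up_set X x \<longleftrightarrow> y \<in> topspace X \<and> (\<forall>U. openin X U \<and> x \<in> U \<longrightarrow> y \<in> U)"
  by (auto simp: up_set_def specialization_le_def in_closure_of)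

lemma openin_upper_vietoris_box:
  "openin X U \<Longrightarrow> openin (upper_vietoris X) (vietoris_box X U)"
  unfolding openin_upper_vietoris by (intro arbitrary_union_of_inc) auto

lemma up_set_in_vietoris_box:
  "openin X U \<Longrightarrow> x \<in> U \<Longrightarrow> up_set X x \<in> vietoris_box X U"
  using openin_subset[of X U]
  by (auto simp: vietoris_box_def mem_up_set_iff up_set_in_compact_saturated_sets subset_iff)

text \<open>The order on \<open>compact_saturated_sets X\<close> enters only through the topology
  \<open>T\<close>, so the argument is run for any \<open>T\<close> in which all boxes are
  open.\<close>

lemma sober_space_if_finer_than_upper_vietoris:
  assumes t0: "t0_space X"
    and top: "topspace T = compact_saturated_sets X"
    and box: "\<And>U. openin X U \<Longrightarrow> openin T (vietoris_box X U)"
    and cont: "continuous_map X T (up_set X)"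
    and sober: "sober_space T"
  shows "sober_space X"
  unfolding sober_space_def
proof (intro allI impI)
  fix A
  assume A: "closedin X A \<and> irreducible_in X A"
  then have AX: "A \<subseteq> topspace X"
    by (simp add: closedin_subset)
  have "irreducible_in T (T closure_of (up_set X ` A))"
    using A cont by (blast intro: irreducible_in_closure_of irreducible_in_continuous_map_image)
  then obtain K where K: "K \<in> topspace T" "T closure_of (up_set X ` A) = T closure_of {K}"
    using sober unfolding sober_space_def by (meson closedin_closure_of)
  have KX: "K \<subseteq> topspace X"
    using K(1) by (auto simp: top compact_saturated_sets_def saturated_in_def)
  have "K \<subseteq> up_set X x" if "x \<in> A" for x
  proof -
    have "up_set X ` A \<subseteq> T closure_of (up_set X ` A)"
      using AX by (intro closure_of_subset) (auto simp: top up_set_in_compact_saturated_sets)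
    then have x: "up_set X x \<in> T closure_of {K}"
      using that K(2) by auto
    have "K \<subseteq> U" if "openin X U" "x \<in> U" for U
    proof -
      \<comment> \<open>An open set containing a point of the closure of \<open>{K}\<close> must
        meet \<open>{K}\<close>.\<close>
      have "K \<in> vietoris_box X U"
        using x box[OF that(1)] up_set_in_vietoris_box[OF that] by (auto simp: in_closure_of)
      then show ?thesis
        by (simp add: vietoris_box_def)
    qed
    then show ?thesis
      \<comment> \<open>\<open>up_set X x\<close> is the intersection of all open neighbourhoods of
        \<open>x\<close>.\<close>
      using KX unfolding subset_iff mem_up_set_iff[OF subsetD[OF AX that]] by blast
  qed
  moreover have "K \<inter> A \<noteq> {}"
  proof
    assume "K \<inter> A = {}"
    then have "K \<in> vietoris_box X (topspace X - A)"
      using K(1) KX by (auto simp: vietoris_box_def top)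
    moreover have "K \<in> T closure_of (up_set X ` A)"
      using K closure_of_subset[of "{K}" T] by auto
    moreover have "openin T (vietoris_box X (topspace X - A))"
      using A by (intro box) auto
    ultimately have "\<exists>L\<in>up_set X ` A. L \<in> vietoris_box X (topspace X - A)"
      unfolding in_closure_of by meson
    then obtain x where "x \<in> A" "up_set X x \<in> vietoris_box X (topspace X - A)"
      by auto
    \<comment> \<open>By reflexivity \<open>x\<close> is a point of \<open>up_set X x\<close>, which
      was to avoid \<open>A\<close>.\<close>
    moreover from this(1) have "x \<in> up_set X x"
      using AX by (auto simp: mem_up_set_iff)
    ultimately show False
      by (auto simp: vietoris_box_def)
  qed
  ultimately obtain k where k: "k \<in> A" "\<And>x. x \<in> A \<Longrightarrow> k \<in> up_set X x"
    by blast
  \<comment> \<open>That \<open>k\<close> lies above \<open>x\<close> says exactly that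
    \<open>x\<close> is in the closure of \<open>{k}\<close>.\<close>
  have "A \<subseteq> X closure_of {k}"
    using k(2) by (auto simp: up_set_def specialization_le_def)
  moreover have "X closure_of {k} \<subseteq> A"
    using A k(1) by (intro closure_of_minimal) auto
  ultimately have "A = X closure_of {k}"
    by (rule subset_antisym)
  moreover have "k \<in> topspace X"
    using k(1) AX by blast
  ultimately show "\<exists>!x. x \<in> topspace X \<and> A = X closure_of {x}"
    by (intro ex1I[of _ k]) (simp_all add: t0_space_closure_of_singleton_inj[OF t0])
qed

theorem theorem1:
  fixes X :: "'a topology"
  assumes "t0_space X"
    and "\<And>W. openin (upper_vietoris X) W \<Longrightarrow> openin (scott_topology (smyth_poset X)) W"
    and "continuous_map X (scott_topology (smyth_poset X)) (up_set X)"
    and "sober_space (scott_topology (smyth_poset X))"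
  shows "sober_space X"
proof (rule sober_space_if_finer_than_upper_vietoris)
  show "topspace (scott_topology (smyth_poset X)) = compact_saturated_sets X"
    by (simp add: topspace_scott_topology partial_order_smyth_poset) (simp add: smyth_poset_def)
\<comment> \<open>Boxes are upper Vietoris open, hence Scott open by the assumed inclusion.\<close>
qed (simp_all add: assms openin_upper_vietoris_box)

end
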